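(* Let $p$ be a prime number and let $1 \leq e_1 \leq \cdots \leq e_n$ be integers. For $1 \le k \le n$ define \[d_k = \max \{l \in \{1,\ldots,n\} : e_l = e_k\}, \qquad c_k = \min \{l \in \{1,\ldots,n\} : e_l = e_k\}.\] Then the Abelian group $H_p = \mathbb{Z}/p^{e_1}\mathbb{Z} \times \cdots \times \mathbb{Z}/p^{e_n}\mathbb{Z}$ has \[|\mathrm{Aut}(H_p)| = \prod_{k=1}^{n}\left(p^{d_k}-p^{k-1}\right) \prod_{j=1}^{n}(p^{e_j})^{n-d_j} \prod_{i=1}^{n}(p^{e_i-1})^{n-c_i+1}.\]
   Context: $\mathrm{Aut}(H_p)$ denotes the group of automorphisms of the (additive) group $H_p$. *)

theory Defs
  imports "HOL-Algebra.Product_Groups" "HOL-Algebra.Bij" "HOL-Computational_Algebra.Primes"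
begin

definition last_equal :: "nat \<Rightarrow> (nat \<Rightarrow> nat) \<Rightarrow> nat \<Rightarrow> nat"
  where "last_equal n e k = Max {l \<in> {1..n}. e l = e k}"

definition first_equal :: "nat \<Rightarrow> (nat \<Rightarrow> nat) \<Rightarrow> nat \<Rightarrow> nat"
  where "first_equal n e k = Min {l \<in> {1..n}. e l = e k}"

text \<open>The group is written multiplicatively in the library's monoid record, but the operation of
  each factor is addition modulo \<open>p ^ e i\<close>. Elements are functions that are
  \<open>undefined\<close> outside \<open>{1..n}\<close>.\<close>

definition H_group :: "nat \<Rightarrow> nat \<Rightarrow> (nat \<Rightarrow> nat) \<Rightarrow> (nat \<Rightarrow> int) monoid"
  where "H_group p n e = product_group {1..n} (\<lambda>i. integer_mod_group (p ^ e i))"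

end

theory Submission
  imports Defs
begin

text \<open>An endomorphism of \<open>H\<close> is given by the images \<open>h\<^sub>k\<close> of the unit vectors, and \<open>h\<^sub>k\<close> may be any element
  of \<open>A\<^sub>k\<close>, the kernel of \<open>p ^ e k\<close>. Since \<open>H\<close> is a finite \<open>p\<close>-group, the endomorphism is bijective iff
  the \<open>h\<^sub>k\<close> generate \<open>H\<close> modulo \<open>pH\<close>; as \<open>H / pH\<close> has order \<open>p ^ n\<close>, this means that \<open>h\<^sub>k\<close> never lies in
  the subgroup \<open>B\<close> generated by \<open>pH, h\<^sub>1, \<dots>, h\<^bsub>k-1\<^esub>\<close>. Because \<open>A\<^sub>1 \<subseteq> A\<^sub>2 \<subseteq> \<dots>\<close>, the modular law gives
  \<open>card (A\<^sub>k \<inter> B) = p ^ (k - 1) * card (A\<^sub>k \<inter> pH)\<close>, while \<open>card A\<^sub>k = p ^ d k * card (A\<^sub>k \<inter> pH)\<close>. So the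
  \<open>k\<close>-th choice contributes the factor \<open>(p ^ d k - p ^ (k - 1)) * card (A\<^sub>k \<inter> pH)\<close>.\<close>

section \<open>Independent tuples in an abelian group\<close>

context comm_group
begin

section \<open>Adjoining one element to a subgroup\<close>

definition adjoin :: "'a set \<Rightarrow> 'a \<Rightarrow> 'a set"
  where "adjoin B h = B <#> generate G {h}"

lemma mem_adjoin_iff:
  assumes "h \<in> carrier G"
  shows "x \<in> adjoin B h \<longleftrightarrow> (\<exists>b\<in>B. \<exists>i::int. x = b \<otimes> h [^] i)"
  using assms by (auto simp: adjoin_def set_mult_def generate_pow)

lemma subgroup_adjoin:
  assumes "subgroup B G" "h \<in> carrier G"
  shows "subgroup (adjoin B h) G"
  unfolding adjoin_def using assms by (intro mult_subgroups generate_is_subgroup) auto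

lemma adjoin_superset:
  assumes "subgroup B G" "h \<in> carrier G"
  shows "B \<subseteq> adjoin B h"
proof
  fix b assume "b \<in> B"
  then have "b = b \<otimes> h [^] (0::int)"
    using subgroup.mem_carrier[OF assms(1)] by simp
  then show "b \<in> adjoin B h"
    using \<open>b \<in> B\<close> assms(2) by (subst mem_adjoin_iff) blast+
qed

lemma adjoin_self:
  assumes "subgroup B G" "h \<in> carrier G"
  shows "h \<in> adjoin B h"
proof -
  have "h = \<one> \<otimes> h [^] (1::int)"
    using assms(2) by simp
  then show ?thesis
    using subgroup.one_closed[OF assms(1)] assms(2) by (subst mem_adjoin_iff) blast+
qed

lemma adjoin_least:
  assumes "subgroup C G" "B \<subseteq> C" "h \<in> C"
  shows "adjoin B h \<subseteq> C"
proof
  fix x assume x: "x \<in> adjoin B h"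
  have "h \<in> carrier G"
    using assms subgroup.mem_carrier by metis
  with x obtain b and i :: int where "b \<in> B" "x = b \<otimes> h [^] i"
    by (auto simp: mem_adjoin_iff)
  then show "x \<in> C"
    using assms subgroup_int_pow_closed subgroup.m_closed by (metis subsetD)
qed

lemma adjoin_absorb:
  assumes "subgroup B G" "h \<in> B"
  shows "adjoin B h = B"
  using adjoin_least[OF assms(1) order_refl assms(2)] adjoin_superset[OF assms(1)]
    subgroup.mem_carrier[OF assms] by blast

text \<open>The modular law: since \<open>h\<close> lies in \<open>A\<close>, multiplying by a power
  of \<open>h\<close> does not change membership in \<open>A\<close>.\<close>

lemma adjoin_Int:
  assumes "subgroup A G" "h \<in> A" "B \<subseteq> carrier G"
  shows "A \<inter> adjoin B h = adjoin (A \<inter> B) h"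
proof -
  have h: "h \<in> carrier G"
    using assms subgroup.mem_carrier by metis
  have "b \<otimes> h [^] i \<in> A \<longleftrightarrow> b \<in> A" if "b \<in> B" for b and i :: int
  proof
    have hi: "h [^] i \<in> A"
      using assms subgroup_int_pow_closed by blast
    show "b \<in> A" if "b \<otimes> h [^] i \<in> A"
    proof -
      have "b = (b \<otimes> h [^] i) \<otimes> inv (h [^] i)"
        using \<open>b \<in> B\<close> assms(3) h by (auto simp: m_assoc)
      then show ?thesis
        using that hi assms(1) by (metis subgroup.m_closed subgroup.m_inv_closed)
    qed
    show "b \<otimes> h [^] i \<in> A" if "b \<in> A"
      using that hi assms(1) by (simp add: subgroup.m_closed)
  qed
  then show ?thesis
    unfolding set_eq_iff Int_iff mem_adjoin_iff[OF h] by blast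
qed

text \<open>An exponent prime to \<open>p\<close> satisfies a Bezout identity with \<open>p\<close>,
  so \<open>h\<close> is a product of powers of \<open>h [^] p\<close> and
  \<open>h [^] i\<close>.\<close>

lemma int_pow_prime_mem_imp:
  fixes p :: nat and i :: int
  assumes "subgroup B G" "h \<in> carrier G" "prime p" "h [^] p \<in> B" "h [^] i \<in> B" "\<not> int p dvd i"
  shows "h \<in> B"
proof -
  have "gcd (int p) i = 1"
    using assms prime_imp_coprime[of "int p" i] by simp
  then obtain u v where uv: "u * int p + v * i = 1"
    by (metis bezout_int)
  have "h = (h [^] int p) [^] u \<otimes> (h [^] i) [^] v"
    using assms(2) uv by (simp add: int_pow_pow flip: int_pow_mult) (simp add: mult.commute)
  moreover have "h [^] int p \<in> B"
    using assms(4) by (simp add: int_pow_int)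
  ultimately show ?thesis
    using assms subgroup_int_pow_closed subgroup.m_closed by metis
qed

text \<open>Modulo \<open>B\<close> the element \<open>h\<close> has order exactly \<open>p\<close>,
  so the products of an element of \<open>B\<close> with \<open>h [^] i\<close>, where 0 <= i < p,
  list the new subgroup without repetition.\<close>

lemma card_adjoin:
  assumes B: "subgroup B G" and h: "h \<in> carrier G" and "prime p" "h [^] p \<in> B" "h \<notin> B"
  shows "card (adjoin B h) = p * card B"
proof -
  let ?f = "\<lambda>(b, i::int). b \<otimes> h [^] i"
  have p: "p > 0"
    using assms(3) prime_gt_0_nat by blast
  have Bc: "b \<in> carrier G" if "b \<in> B" for b
    using that subgroup.mem_carrier[OF B] by blast
  have hp: "h [^] int p \<in> B"
    using assms(4) by (simp add: int_pow_int)
  have inj: "inj_on ?f (B \<times> {0..<int p})"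
  proof (rule inj_onI, clarify)
    fix c c' :: 'a and i i' :: int
    assume c: "c \<in> B" "c' \<in> B" and i: "i \<in> {0..<int p}" "i' \<in> {0..<int p}"
      and eq: "c \<otimes> h [^] i = c' \<otimes> h [^] i'"
    have "h [^] (i - i') = inv c \<otimes> c'"
    proof -
      have "h [^] i = inv c \<otimes> (c' \<otimes> h [^] i')"
        using Bc c h by (simp add: eq[symmetric] flip: m_assoc)
      then show ?thesis
        using Bc c h by (simp add: int_pow_diff m_assoc)
    qed
    then have "h [^] (i - i') \<in> B"
      using c B by (simp add: subgroup.m_closed subgroup.m_inv_closed)
    then have "int p dvd i - i'"
      using int_pow_prime_mem_imp[OF B h assms(3,4)] assms(5) by blast
    then have "i = i'"
      using i by (metis atLeastLessThan_iff mod_eq_dvd_iff mod_pos_pos_trivial)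
    with eq Bc c h show "c = c' \<and> i = i'"
      by simp
  qed
  have "?f ` (B \<times> {0..<int p}) = adjoin B h"
  proof (intro equalityI subsetI)
    fix x assume "x \<in> adjoin B h"
    then obtain b and i :: int where b: "b \<in> B" and x: "x = b \<otimes> h [^] i"
      using h by (auto simp: mem_adjoin_iff)
    \<comment> \<open>Reduce the exponent modulo \<open>p\<close>; the remaining power of
      \<open>h [^] p\<close> is absorbed into \<open>B\<close>.\<close>
    have "h [^] i = h [^] (int p * (i div int p) + i mod int p)"
      by simp
    also have "\<dots> = (h [^] int p) [^] (i div int p) \<otimes> h [^] (i mod int p)"
      using h by (simp only: int_pow_mult int_pow_pow)
    finally have "x = ?f (b \<otimes> (h [^] int p) [^] (i div int p), i mod int p)"
      using x b Bc h by (simp add: m_assoc)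
    moreover have "b \<otimes> (h [^] int p) [^] (i div int p) \<in> B"
      using b hp B subgroup_int_pow_closed subgroup.m_closed by metis
    ultimately show "x \<in> ?f ` (B \<times> {0..<int p})"
      using p by (intro image_eqI[where x = "(b \<otimes> (h [^] int p) [^] (i div int p), i mod int p)"]) auto
  qed (use h in \<open>auto simp: mem_adjoin_iff\<close>)
  then show ?thesis
    using card_image[OF inj] by (simp add: card_cartesian_product mult.commute)
qed

section \<open>Chains of adjunctions and the count of independent tuples\<close>

fun chain :: "'a set \<Rightarrow> (nat \<Rightarrow> 'a) \<Rightarrow> nat \<Rightarrow> 'a set" where
  "chain P h 0 = P"
| "chain P h (Suc k) = adjoin (chain P h k) (h (Suc k))"

lemma chain_cong:
  assumes "\<And>i. i \<in> {1..k} \<Longrightarrow> h i = h' i"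
  shows "chain P h k = chain P h' k"
  using assms by (induction k) auto

lemma subgroup_chain:
  assumes "subgroup P G" "\<And>i. i \<in> {1..k} \<Longrightarrow> h i \<in> carrier G"
  shows "subgroup (chain P h k) G"
  using assms(2)
proof (induction k)
  case (Suc k)
  then have "subgroup (chain P h k) G" "h (Suc k) \<in> carrier G"
    by simp_all
  then show ?case
    by (simp add: subgroup_adjoin)
qed (simp add: assms(1))

lemma chain_subset_Suc:
  assumes "subgroup P G" "\<And>i. i \<in> {1..Suc k} \<Longrightarrow> h i \<in> carrier G"
  shows "chain P h k \<subseteq> chain P h (Suc k)"
proof -
  have "subgroup (chain P h k) G"
    using assms by (intro subgroup_chain) auto
  then show ?thesis
    using assms(2) by (simp add: adjoin_superset)
qed

lemma base_subset_chain:
  assumes "subgroup P G" "\<And>i. i \<in> {1..k} \<Longrightarrow> h i \<in> carrier G"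
  shows "P \<subseteq> chain P h k"
  using assms(2)
proof (induction k)
  case (Suc k)
  then have "P \<subseteq> chain P h k"
    by simp
  also have "\<dots> \<subseteq> chain P h (Suc k)"
    using chain_subset_Suc[OF assms(1) Suc.prems] .
  finally show ?case .
qed simp

lemma mem_chain:
  assumes "subgroup P G" "\<And>i. i \<in> {1..k} \<Longrightarrow> h i \<in> carrier G" "i \<in> {1..k}"
  shows "h i \<in> chain P h k"
  using assms(2,3)
proof (induction k)
  case (Suc k)
  show ?case
  proof (cases "i = Suc k")
    case True
    have "subgroup (chain P h k) G"
      using Suc.prems by (intro subgroup_chain assms(1)) auto
    then show ?thesis
      using Suc.prems True by (simp add: adjoin_self)
  next
    case False
    then have "h i \<in> chain P h k"
      using Suc by simp
    then show ?thesis
      using chain_subset_Suc[of P k h, OF assms(1) Suc.prems(1)] by blast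
  qed
qed simp

lemma chain_least:
  assumes "subgroup C G" "P \<subseteq> C" "\<And>i. i \<in> {1..k} \<Longrightarrow> h i \<in> C"
  shows "chain P h k \<subseteq> C"
  using assms(3)
proof (induction k)
  case (Suc k)
  then have "chain P h k \<subseteq> C" "h (Suc k) \<in> C"
    by simp_all
  then show ?case
    using adjoin_least[OF assms(1)] by simp
qed (simp add: assms(2))

text \<open>When \<open>P\<close> contains all \<open>p\<close>-th powers, the quotient by
  \<open>P\<close> is a vector space over the field with \<open>p\<close> elements, and these are
  the tuples that are linearly independent modulo \<open>P\<close>. Membership in \<open>PiE\<close>
  fixes the values outside the index range, so each tuple is counted once.\<close>

definition independent_tuples :: "'a set \<Rightarrow> (nat \<Rightarrow> 'a set) \<Rightarrow> nat \<Rightarrow> (nat \<Rightarrow> 'a) set"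
  where "independent_tuples P A k =
    {h \<in> PiE {1..k} A. \<forall>j\<in>{1..k}. h j \<notin> chain P h (j - 1)}"

text \<open>By the modular law, intersecting with \<open>A\<close> commutes with adjoining an
  element of \<open>A\<close>. Each adjunction then multiplies the order by \<open>p\<close>,
  because the \<open>p\<close>-th power of the new element lies both in \<open>A\<close> and in
  \<open>P\<close>, hence in the previous link of the chain.\<close>

lemma card_Int_chain:
  assumes P: "subgroup P G" "\<And>x. x \<in> carrier G \<Longrightarrow> x [^] p \<in> P" and "prime p"
    and A: "subgroup A G" "\<And>i. i \<in> {1..k} \<Longrightarrow> h i \<in> A"
    and indep: "\<And>i. i \<in> {1..k} \<Longrightarrow> h i \<notin> chain P h (i - 1)"
  shows "card (A \<inter> chain P h k) = p ^ k * card (A \<inter> P)"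
  using A(2) indep
proof (induction k)
  case (Suc k)
  have h: "h i \<in> carrier G" if "i \<in> {1..Suc k}" for i
    using that Suc.prems(1) subgroup.mem_carrier[OF A(1)] by blast
  have C: "subgroup (chain P h k) G"
    using P h by (auto intro: subgroup_chain)
  have "h (Suc k) [^] p \<in> A \<inter> chain P h k"
  proof
    show "h (Suc k) [^] p \<in> A"
      using Suc.prems(1)[of "Suc k"] subgroup_int_pow_closed[OF A(1), of _ "int p"] by (simp add: int_pow_int)
    show "h (Suc k) [^] p \<in> chain P h k"
      using P h base_subset_chain[OF P(1), of k h] by auto
  qed
  then have "card (adjoin (A \<inter> chain P h k) (h (Suc k))) = p * card (A \<inter> chain P h k)"
    using Suc.prems(2)[of "Suc k"] h assms(3)
    by (intro card_adjoin subgroups_Inter_pair A C) auto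
  moreover have "A \<inter> chain P h (Suc k) = adjoin (A \<inter> chain P h k) (h (Suc k))"
    using adjoin_Int[OF A(1)] Suc.prems(1) subgroup.subset[OF C] by simp
  ultimately show ?case
    using Suc by simp
qed simp

text \<open>The entries are chosen one after another, and the number of choices for the next one
  does not depend on the earlier ones. Monotonicity puts the earlier entries into the set from which
  the next one is taken, as \<open>card_Int_chain\<close> requires.\<close>

lemma card_independent_tuples:
  assumes fin: "finite (carrier G)"
    and P: "subgroup P G" "\<And>x. x \<in> carrier G \<Longrightarrow> x [^] p \<in> P" and "prime p"
    and A: "\<And>i. i \<in> {1..k} \<Longrightarrow> subgroup (A i) G"
    and mono: "\<And>i j. 1 \<le> i \<Longrightarrow> i \<le> j \<Longrightarrow> j \<le> k \<Longrightarrow> A i \<subseteq> A j"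
  shows "int (card (independent_tuples P A k)) =
    (\<Prod>j=1..k. int (card (A j)) - int p ^ (j - 1) * int (card (A j \<inter> P)))"
  using A mono
proof (induction k)
  case 0
  have "independent_tuples P A 0 = {\<lambda>_. undefined}"
    by (auto simp: independent_tuples_def)
  then show ?case by simp
next
  case (Suc k)
  let ?S = "Sigma (independent_tuples P A k) (\<lambda>h. A (Suc k) - chain P h k)"
  let ?f = "\<lambda>(h, a). h(Suc k := a)"
  have fA: "finite (A i)" if "i \<in> {1..Suc k}" for i
    using Suc.prems(1)[OF that] fin by (meson rev_finite_subset subgroup.subset)
  have finT: "finite (independent_tuples P A k)"
    unfolding independent_tuples_def using fA
    by (intro finite_subset[OF Collect_subset] finite_PiE) auto
  have chain_upd: "chain P (h(Suc k := a)) j = chain P h j" if "j \<le> k" for h a j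
    using that by (intro chain_cong) auto
  have "bij_betw ?f ?S (independent_tuples P A (Suc k))"
  \<comment> \<open>The inverse splits off the last entry; \<open>restrict\<close> resets position
    \<open>Suc k\<close> to \<open>undefined\<close>, as the extensional function space
    demands.\<close>
  proof (rule bij_betwI[where g = "\<lambda>h. (restrict h {1..k}, h (Suc k))"])
    show "?f \<in> ?S \<rightarrow> independent_tuples P A (Suc k)"
    proof (clarify)
      fix h a assume h: "h \<in> independent_tuples P A k" and a: "a \<in> A (Suc k)" "a \<notin> chain P h k"
      have "h(Suc k := a) \<in> PiE {1..Suc k} A"
        using h a by (auto simp: independent_tuples_def PiE_iff extensional_def)
      moreover have "(h(Suc k := a)) j \<notin> chain P (h(Suc k := a)) (j - 1)" if "j \<in> {1..Suc k}" for j
      proof (cases "j = Suc k")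
        case False
        then have "j \<in> {1..k}"
          using that by auto
        then show ?thesis
          using h chain_upd[of "j - 1" h a] by (auto simp: independent_tuples_def)
      qed (use a chain_upd in auto)
      ultimately show "h(Suc k := a) \<in> independent_tuples P A (Suc k)"
        by (auto simp: independent_tuples_def)
    qed
    show "(\<lambda>h. (restrict h {1..k}, h (Suc k))) \<in> independent_tuples P A (Suc k) \<rightarrow> ?S"
    proof
      fix h assume h: "h \<in> independent_tuples P A (Suc k)"
      have c: "chain P (restrict h {1..k}) j = chain P h j" if "j \<le> k" for j
        using that by (intro chain_cong) auto
      have "restrict h {1..k} \<in> independent_tuples P A k"
        unfolding independent_tuples_def
      proof (intro CollectI conjI ballI)
        show "restrict h {1..k} \<in> PiE {1..k} A"
          using h by (auto simp: independent_tuples_def)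
        fix j assume j: "j \<in> {1..k}"
        then have "j \<in> {1..Suc k}" by auto
        then have "h j \<notin> chain P h (j - 1)"
          using h unfolding independent_tuples_def by blast
        then show "restrict h {1..k} j \<notin> chain P (restrict h {1..k}) (j - 1)"
          using j c[of "j - 1"] by auto
      qed
      moreover have "h (Suc k) \<notin> chain P h k"
        using h by (force simp: independent_tuples_def)
      moreover have "h (Suc k) \<in> A (Suc k)"
        using h by (auto simp: independent_tuples_def)
      ultimately show "(restrict h {1..k}, h (Suc k)) \<in> ?S"
        using c by auto
    qed
    show "(restrict (?f z) {1..k}, ?f z (Suc k)) = z" if "z \<in> ?S" for z
      using that by (auto simp: independent_tuples_def fun_eq_iff PiE_iff extensional_def)
    show "?f (restrict h {1..k}, h (Suc k)) = h" if "h \<in> independent_tuples P A (Suc k)" for h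
      using that by (auto simp: independent_tuples_def fun_eq_iff PiE_iff extensional_def)
  qed
  then have "int (card (independent_tuples P A (Suc k))) = int (card ?S)"
    by (simp add: bij_betw_same_card)
  also have "\<dots> = (\<Sum>h\<in>independent_tuples P A k. int (card (A (Suc k) - chain P h k)))"
    using finT fA by (subst card_SigmaI) auto
  \<comment> \<open>The summand is evaluated only at an existing independent tuple. If there is
    none, the sum is empty, so a possibly negative integer difference does no harm.\<close>
  also have "\<dots> = (\<Sum>h\<in>independent_tuples P A k.
      int (card (A (Suc k))) - int p ^ k * int (card (A (Suc k) \<inter> P)))"
  proof (rule sum.cong[OF refl])
    fix h assume h: "h \<in> independent_tuples P A k"
    have "card (A (Suc k) \<inter> chain P h k) = p ^ k * card (A (Suc k) \<inter> P)"
    proof (rule card_Int_chain[OF P \<open>prime p\<close>])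
      show "h i \<in> A (Suc k)" if "i \<in> {1..k}" for i
        using h that Suc.prems(2)[of i "Suc k"] by (auto simp: independent_tuples_def)
      show "h i \<notin> chain P h (i - 1)" if "i \<in> {1..k}" for i
        using h that by (auto simp: independent_tuples_def)
    qed (use Suc.prems in auto)
    moreover have "card (A (Suc k)) = card (A (Suc k) - chain P h k) + card (A (Suc k) \<inter> chain P h k)"
      using fA[of "Suc k"] by (subst card_Un_disjoint[symmetric]) (auto intro: arg_cong[where f = card])
    ultimately show "int (card (A (Suc k) - chain P h k)) =
        int (card (A (Suc k))) - int p ^ k * int (card (A (Suc k) \<inter> P))"
      by simp
  qed
  also have "\<dots> = int (card (independent_tuples P A k)) *
      (int (card (A (Suc k))) - int p ^ k * int (card (A (Suc k) \<inter> P)))"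
    by simp
  finally show ?case
    using Suc by simp
qed

text \<open>Each link multiplies the order by \<open>p\<close> or by 1, according to whether the new
  element is outside or inside the previous link. Starting from \<open>card P\<close>, the full
  order is reached after \<open>n\<close> links exactly when no link is wasted.\<close>

lemma chain_eq_carrier_iff:
  assumes fin: "finite (carrier G)"
    and P: "subgroup P G" "\<And>x. x \<in> carrier G \<Longrightarrow> x [^] p \<in> P" and "prime p"
    and ord: "card (carrier G) = p ^ n * card P"
    and h: "\<And>i. i \<in> {1..n} \<Longrightarrow> h i \<in> carrier G"
  shows "chain P h n = carrier G \<longleftrightarrow> (\<forall>j\<in>{1..n}. h j \<notin> chain P h (j - 1))"
proof
  have sub: "subgroup (chain P h k) G" if "k \<le> n" for k
    using that h by (intro subgroup_chain P) auto
  have Pc: "card P > 0"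
    using subgroup.subset[OF P(1)] subgroup.one_closed[OF P(1)] fin
    by (metis card_gt_0_iff empty_iff finite_subset)
  have step: "card (chain P h (Suc k)) = (if h (Suc k) \<in> chain P h k then 1 else p) * card (chain P h k)"
    if "Suc k \<le> n" for k
  proof (cases "h (Suc k) \<in> chain P h k")
    case True
    then show ?thesis
      using that sub[of k] by (simp add: adjoin_absorb)
  next
    case False
    have "h (Suc k) [^] p \<in> chain P h k"
      using that P(2)[of "h (Suc k)"] h base_subset_chain[OF P(1), of k h] by auto
    then show ?thesis
      using that False sub[of k] h \<open>prime p\<close> by (simp add: card_adjoin)
  qed
  {
    assume "\<forall>j\<in>{1..n}. h j \<notin> chain P h (j - 1)"
    then have "card (carrier G \<inter> chain P h n) = p ^ n * card (carrier G \<inter> P)"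
      using h by (intro card_Int_chain P \<open>prime p\<close> subgroup_self) auto
    then have "card (chain P h n) = card (carrier G)"
      using sub[of n] P(1) ord by (simp add: Int_absorb1 subgroup.subset)
    then show "chain P h n = carrier G"
      using sub[of n] fin by (simp add: card_subset_eq subgroup.subset)
  }
  assume eq: "chain P h n = carrier G"
  show "\<forall>j\<in>{1..n}. h j \<notin> chain P h (j - 1)"
  proof (rule ccontr)
    assume "\<not> (\<forall>j\<in>{1..n}. h j \<notin> chain P h (j - 1))"
    then obtain j where j: "j \<in> {1..n}" "h j \<in> chain P h (j - 1)"
      by blast
    have p1: "p > 1"
      using \<open>prime p\<close> prime_gt_1_nat by blast
    \<comment> \<open>The induction carries the weak bound for all links and the strict one from the
      wasted link \<open>j\<close> onwards; at \<open>n\<close> the strict bound contradicts the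
      order of the group.\<close>
    have "card (chain P h k) \<le> p ^ k * card P \<and> (j \<le> k \<longrightarrow> card (chain P h k) < p ^ k * card P)"
      if "k \<le> n" for k
      using that
    proof (induction k)
      case 0
      then show ?case using j by simp
    next
      case (Suc k)
      show ?case
      proof (cases "h (Suc k) \<in> chain P h k")
        case True
        have "card (chain P h (Suc k)) \<le> p ^ k * card P"
          using step[OF Suc.prems] Suc True by simp
        also have "\<dots> < p ^ Suc k * card P"
          using p1 Pc by simp
        finally show ?thesis by simp
      next
        case False
        then have "j \<noteq> Suc k"
          using j by auto
        then show ?thesis
          using step[OF Suc.prems] Suc False p1 by (auto simp: mult.assoc)
      qed
    qed
    from this[of n] j eq ord show False
      by simp
  qed
qed

text \<open>Nakayama's lemma for abelian \<open>p\<close>-groups: iterate the hypothesis on the \<open>p\<close>-th power factor.\<close>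

lemma subgroup_mult_powers_eq_carrier:
  assumes I: "subgroup I G" and gen: "\<And>x. x \<in> carrier G \<Longrightarrow> \<exists>y\<in>I. \<exists>z\<in>carrier G. x = y \<otimes> z [^] (p::nat)"
    and tors: "\<And>x. x \<in> carrier G \<Longrightarrow> x [^] (p ^ m :: nat) = \<one>"
  shows "I = carrier G"
proof -
  have "\<exists>y\<in>I. \<exists>z\<in>carrier G. x = y \<otimes> z [^] (p ^ k)" if "x \<in> carrier G" for x and k :: nat
  proof (induction k)
    case 0
    have "x = \<one> \<otimes> x [^] (p ^ 0)"
      using that by simp
    then show ?case
      using that subgroup.one_closed[OF I] by blast
  next
    case (Suc k)
    then obtain y z where yz: "y \<in> I" "z \<in> carrier G" "x = y \<otimes> z [^] (p ^ k)"
      by blast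
    obtain u v where uv: "u \<in> I" "v \<in> carrier G" "z = u \<otimes> v [^] p"
      using gen yz by blast
    have uc: "u \<in> carrier G" "y \<in> carrier G"
      using uv yz subgroup.mem_carrier[OF I] by blast+
    have "x = (y \<otimes> u [^] (p ^ k)) \<otimes> v [^] (p ^ Suc k)"
      using yz uv uc by (simp add: nat_pow_distrib nat_pow_pow m_assoc)
    moreover have "y \<otimes> u [^] (p ^ k) \<in> I"
      using yz uv subgroup_int_pow_closed[OF I, of u "int (p ^ k)"] subgroup.m_closed[OF I]
      by (simp add: int_pow_int del: of_nat_power)
    ultimately show ?case
      using uv by blast
  qed
  from this[of _ m] have "x \<in> I" if "x \<in> carrier G" for x
    using that tors subgroup.mem_carrier[OF I] by (metis r_one)
  then show ?thesis
    using subgroup.subset[OF I] by blast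
qed

end

section \<open>The group \<open>H\<^sub>p\<close>\<close>

text \<open>Truncated subtraction covers both cases: if \<open>a\<close> is at most
  \<open>b\<close>, both sides hold; otherwise the common factor p^b cancels.\<close>

lemma prime_power_dvd_mult_power_iff:
  fixes p :: nat and x :: int
  assumes "p > 0"
  shows "int p ^ a dvd int p ^ b * x \<longleftrightarrow> int p ^ (a - b) dvd x"
proof (cases "a \<le> b")
  case True
  then show ?thesis
    by (simp add: dvd_mult2 le_imp_power_dvd)
next
  case False
  then have "int p ^ a = int p ^ b * int p ^ (a - b)"
    by (simp flip: power_add)
  then show ?thesis
    using assms by simp
qed

lemma card_multiples_prime_power:
  fixes p :: nat
  assumes "p > 0" "r \<le> m"
  shows "card {a \<in> {0..<int p ^ m}. int p ^ r dvd a} = p ^ (m - r)"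
proof -
  define q where "q = int p ^ (m - r)"
  have pm: "int p ^ m = int p ^ r * q"
    using assms(2) by (simp add: q_def flip: power_add)
  have pos: "int p ^ r > 0"
    using assms(1) by simp
  \<comment> \<open>Dividing by p^r turns the multiples below p^m into all residues below
    p^(m-r).\<close>
  have "{a \<in> {0..<int p ^ m}. int p ^ r dvd a} = (\<lambda>b. int p ^ r * b) ` {0..<q}"
  proof (intro equalityI subsetI)
    fix a assume "a \<in> {a \<in> {0..<int p ^ m}. int p ^ r dvd a}"
    then obtain b where b: "a = int p ^ r * b" "0 \<le> a" "a < int p ^ m"
      by (auto elim: dvdE)
    then have "b \<in> {0..<q}"
      using pos by (simp add: pm zero_le_mult_iff)
    with b(1) show "a \<in> (\<lambda>b. int p ^ r * b) ` {0..<q}"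
      by blast
  qed (use pos in \<open>auto simp: pm\<close>)
  moreover have "inj_on (\<lambda>b. int p ^ r * b) {0..<q}"
    using assms(1) by (simp add: inj_on_def)
  ultimately show ?thesis
    by (simp add: card_image nat_power_eq q_def)
qed

section \<open>Coordinate description of the group\<close>

locale H_group_context =
  fixes p n :: nat and e :: "nat \<Rightarrow> nat"
  assumes prime_p: "prime p"
    and e_pos: "\<And>i. i \<in> {1..n} \<Longrightarrow> 1 \<le> e i"
    and e_mono: "mono_on {1..n} e"
begin

abbreviation "H \<equiv> H_group p n e"

lemma p_gt_1: "p > 1"
  using prime_p prime_gt_1_nat by blast

lemma pow_pos [simp]: "int p ^ m > 0"
  using p_gt_1 by simp

lemma carrier_H: "carrier H = (\<Pi>\<^sub>E i\<in>{1..n}. {0..<int p ^ e i})"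
  using p_gt_1 by (simp add: H_group_def carrier_integer_mod_group)

lemma mult_H: "x \<otimes>\<^bsub>H\<^esub> y = (\<lambda>i\<in>{1..n}. (x i + y i) mod int p ^ e i)"
  by (simp add: H_group_def)

lemma one_H: "\<one>\<^bsub>H\<^esub> = (\<lambda>i\<in>{1..n}. 0)"
  by (simp add: H_group_def)

sublocale H: comm_group H
proof (rule group.group_comm_groupI)
  show "group H"
    by (simp add: H_group_def)
qed (simp add: mult_H add.commute)

lemma inv_H: "x \<in> carrier H \<Longrightarrow> inv\<^bsub>H\<^esub> x = (\<lambda>i\<in>{1..n}. (- x i) mod int p ^ e i)"
  unfolding H_group_def by (subst inv_product_group) (auto simp: PiE_iff intro!: restrict_ext)

lemma pow_H:
  assumes "x \<in> carrier H"
  shows "x [^]\<^bsub>H\<^esub> m = (\<lambda>i\<in>{1..n}. (int m * x i) mod int p ^ e i)"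
  by (induction m) (auto simp: one_H mult_H algebra_simps mod_add_right_eq)

lemma finite_H: "finite (carrier H)"
  unfolding carrier_H by (intro finite_PiE) auto

section \<open>Subgroups cut out by coordinatewise divisibility\<close>

definition multiples :: "(nat \<Rightarrow> nat) \<Rightarrow> (nat \<Rightarrow> int) set"
  where "multiples r = (\<Pi>\<^sub>E i\<in>{1..n}. {a \<in> {0..<int p ^ e i}. int p ^ r i dvd a})"

lemma mem_multiples_iff:
  "x \<in> multiples r \<longleftrightarrow> x \<in> carrier H \<and> (\<forall>i\<in>{1..n}. int p ^ r i dvd x i)"
  by (auto simp: multiples_def carrier_H PiE_iff)

lemma carrier_eq_multiples: "carrier H = multiples (\<lambda>_. 0)"
  by (auto simp: mem_multiples_iff)

lemma multiples_Int: "multiples r \<inter> multiples s = multiples (\<lambda>i. max (r i) (s i))"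
proof -
  have "int p ^ max a b dvd x \<longleftrightarrow> int p ^ a dvd x \<and> int p ^ b dvd x" for a b and x :: int
    by (metis max.cobounded1 max.cobounded2 max_def power_le_dvd)
  then show ?thesis
    by (auto simp: mem_multiples_iff)
qed

lemma multiples_mono:
  assumes "\<And>i. i \<in> {1..n} \<Longrightarrow> s i \<le> r i"
  shows "multiples r \<subseteq> multiples s"
proof
  fix x assume "x \<in> multiples r"
  then have "x \<in> carrier H" "int p ^ s i dvd x i" if "i \<in> {1..n}" for i
    using assms[OF that] that by (auto simp: mem_multiples_iff intro: power_le_dvd)
  then show "x \<in> multiples s"
    using \<open>x \<in> multiples r\<close> by (auto simp: mem_multiples_iff)
qed

lemma card_multiples:
  assumes "\<And>i. i \<in> {1..n} \<Longrightarrow> r i \<le> e i"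
  shows "card (multiples r) = (\<Prod>i=1..n. p ^ (e i - r i))"
proof -
  have "card (multiples r) = (\<Prod>i=1..n. card {a \<in> {0..<int p ^ e i}. int p ^ r i dvd a})"
    unfolding multiples_def by (simp add: card_PiE)
  also have "\<dots> = (\<Prod>i=1..n. p ^ (e i - r i))"
    using assms p_gt_1 by (intro prod.cong card_multiples_prime_power) auto
  finally show ?thesis .
qed

text \<open>Since p^(r i) divides p^(e i), reduction modulo p^(e i) does not affect divisibility by
  p^(r i).\<close>

lemma subgroup_multiples:
  assumes "\<And>i. i \<in> {1..n} \<Longrightarrow> r i \<le> e i"
  shows "subgroup (multiples r) H"
proof
  show "multiples r \<subseteq> carrier H"
    by (auto simp: mem_multiples_iff)
  have dvd: "int p ^ r i dvd a mod int p ^ e i \<longleftrightarrow> int p ^ r i dvd a" if "i \<in> {1..n}" for i a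
    using assms[OF that] by (simp add: dvd_mod_iff le_imp_power_dvd)
  show "x \<otimes>\<^bsub>H\<^esub> y \<in> multiples r" if "x \<in> multiples r" "y \<in> multiples r" for x y
    using that H.m_closed[of x y] by (simp add: mem_multiples_iff mult_H dvd)
  show "\<one>\<^bsub>H\<^esub> \<in> multiples r"
    using H.one_closed by (simp add: mem_multiples_iff one_H)
  show "inv\<^bsub>H\<^esub> x \<in> multiples r" if "x \<in> multiples r" for x
    using that H.inv_closed[of x] by (simp add: mem_multiples_iff inv_H dvd)
qed

text \<open>This is pH, the Frattini subgroup of the \<open>p\<close>-group;
  \<open>mem_frattini_iff\<close> identifies it with the set of \<open>p\<close>-th powers. The form
  as \<open>multiples\<close> gives its order and its intersections directly.\<close>

definition frattini :: "(nat \<Rightarrow> int) set"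
  where "frattini = multiples (\<lambda>_. 1)"

text \<open>This is the kernel of multiplication by p^(e k), see \<open>mem_torsion_iff_pow\<close>.
  The truncated difference leaves coordinates with e i <= e k unrestricted.\<close>

definition torsion :: "nat \<Rightarrow> (nat \<Rightarrow> int) set"
  where "torsion k = multiples (\<lambda>i. e i - e k)"

lemma mem_torsion_iff:
  "x \<in> torsion k \<longleftrightarrow> x \<in> carrier H \<and> (\<forall>i\<in>{1..n}. int p ^ e i dvd int p ^ e k * x i)"
  using p_gt_1 by (simp add: torsion_def mem_multiples_iff prime_power_dvd_mult_power_iff)

lemma mem_torsion_iff_pow:
  "x \<in> torsion k \<longleftrightarrow> x \<in> carrier H \<and> x [^]\<^bsub>H\<^esub> (p ^ e k) = \<one>\<^bsub>H\<^esub>"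
proof (cases "x \<in> carrier H")
  case True
  then show ?thesis
    by (auto simp: mem_torsion_iff pow_H one_H fun_eq_iff restrict_def mod_eq_0_iff_dvd)
qed (simp add: mem_torsion_iff)

lemma subgroup_torsion: "subgroup (torsion k) H"
  unfolding torsion_def by (rule subgroup_multiples) simp

lemma subgroup_frattini: "subgroup frattini H"
  unfolding frattini_def using e_pos by (intro subgroup_multiples) auto

lemma torsion_mono:
  assumes "i \<in> {1..n}" "j \<in> {1..n}" "i \<le> j"
  shows "torsion i \<subseteq> torsion j"
  unfolding torsion_def using mono_onD[OF e_mono assms] by (intro multiples_mono) simp

lemma mem_frattini_iff: "x \<in> frattini \<longleftrightarrow> (\<exists>z\<in>carrier H. x = z [^]\<^bsub>H\<^esub> p)"
proof
  assume x: "x \<in> frattini"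
  \<comment> \<open>The division is exact because \<open>p\<close> divides every coordinate of
    \<open>x\<close>, and the quotient stays in range because it is at most the coordinate
    itself.\<close>
  define z where "z = (\<lambda>i\<in>{1..n}. x i div int p)"
  have xc: "x \<in> carrier H"
    using x by (simp add: frattini_def mem_multiples_iff)
  have z: "z \<in> carrier H"
    unfolding carrier_H z_def
  proof (rule restrict_PiE_iff[THEN iffD2], rule ballI)
    fix i assume "i \<in> {1..n}"
    then have "0 \<le> x i" "x i < int p ^ e i"
      using xc by (auto simp: carrier_H PiE_iff)
    moreover have "x i div int p \<le> x i"
      using zdiv_mono2[of "x i" 1 "int p"] calculation(1) p_gt_1 by simp
    ultimately show "x i div int p \<in> {0..<int p ^ e i}"
      using p_gt_1 by (auto simp: pos_imp_zdiv_nonneg_iff)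
  qed
  have "x = z [^]\<^bsub>H\<^esub> p"
  proof (rule PiE_ext)
    show "x \<in> (\<Pi>\<^sub>E i\<in>{1..n}. {0..<int p ^ e i})" "z [^]\<^bsub>H\<^esub> p \<in> (\<Pi>\<^sub>E i\<in>{1..n}. {0..<int p ^ e i})"
      using xc z H.nat_pow_closed[OF z] by (simp_all only: carrier_H)
    fix i assume i: "i \<in> {1..n}"
    then have "int p * z i = x i" "x i mod int p ^ e i = x i"
      using x xc by (auto simp: z_def frattini_def mem_multiples_iff carrier_H PiE_iff)
    with i show "x i = (z [^]\<^bsub>H\<^esub> p) i"
      by (simp add: pow_H[OF z])
  qed
  with z show "\<exists>z\<in>carrier H. x = z [^]\<^bsub>H\<^esub> p"
    by blast
next
  assume "\<exists>z\<in>carrier H. x = z [^]\<^bsub>H\<^esub> p"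
  then obtain z where z: "z \<in> carrier H" "x = z [^]\<^bsub>H\<^esub> p"
    by blast
  then have "x \<in> carrier H"
    by simp
  moreover have "int p dvd x i" if "i \<in> {1..n}" for i
    using that z(1) e_pos[OF that] by (simp add: z(2) pow_H dvd_mod_iff dvd_power)
  ultimately show "x \<in> frattini"
    by (simp add: frattini_def mem_multiples_iff)
qed

lemma card_carrier: "card (carrier H) = p ^ n * card frattini"
proof -
  have "card (carrier H) = (\<Prod>i=1..n. p * p ^ (e i - 1))"
    unfolding carrier_eq_multiples
  proof (subst card_multiples)
    show "(\<Prod>i=1..n. p ^ (e i - 0)) = (\<Prod>i=1..n. p * p ^ (e i - 1))"
    proof (intro prod.cong refl)
      fix i assume "i \<in> {1..n}"
      then show "p ^ (e i - 0) = p * p ^ (e i - 1)"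
        using e_pos[of i] by (cases "e i") auto
    qed
  qed simp
  also have "\<dots> = p ^ n * card frattini"
    unfolding frattini_def using e_pos by (subst card_multiples) (auto simp: prod.distrib)
  finally show ?thesis .
qed

section \<open>Endomorphisms and automorphisms through the images of the unit vectors\<close>

definition unit :: "nat \<Rightarrow> nat \<Rightarrow> int"
  where "unit k = (\<lambda>i\<in>{1..n}. if i = k then 1 else 0)"

lemma unit_carrier: "unit k \<in> carrier H"
proof -
  have "1 < int p ^ e i" if "i \<in> {1..n}" for i
    using e_pos[OF that] p_gt_1 by (intro one_less_power) auto
  moreover have "0 < int p ^ e i" for i
    by (rule pow_pos)
  ultimately show ?thesis
    unfolding carrier_H unit_def by (intro restrict_PiE_iff[THEN iffD2]) auto
qed

lemma unit_torsion: "unit k \<in> torsion k"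
  using unit_carrier by (auto simp: mem_torsion_iff unit_def)

text \<open>This serves to check a property on unit vectors only: it is applied to the subgroup of
  elements that have the property.\<close>

lemma units_generate:
  assumes K: "subgroup K H" and units: "\<And>k. k \<in> {1..n} \<Longrightarrow> unit k \<in> K"
  shows "K = carrier H"
proof (rule antisym)
  show "K \<subseteq> carrier H"
    using K by (rule subgroup.subset)
  show "carrier H \<subseteq> K"
  proof
    fix x assume x: "x \<in> carrier H"
    have xi: "x i \<in> {0..<int p ^ e i}" if "i \<in> {1..n}" for i
      using that x by (auto simp: carrier_H PiE_iff)
    \<comment> \<open>Truncations of \<open>x\<close> to its first \<open>m\<close> coordinates
      enter \<open>K\<close> one coordinate at a time, by adding the multiple
      \<open>x (Suc m)\<close> of the next unit vector.\<close>
    define trunc where "trunc m = (\<lambda>i\<in>{1..n}. if i \<le> m then x i else 0)" for m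
    have "trunc m \<in> K" if "m \<le> n" for m
      using that
    proof (induction m)
      case 0
      have "trunc 0 = \<one>\<^bsub>H\<^esub>"
        by (auto simp: trunc_def one_H)
      then show ?case
        using subgroup.one_closed[OF K] by simp
    next
      case (Suc m)
      let ?a = "nat (x (Suc m))"
      have m: "Suc m \<in> {1..n}"
        using Suc by auto
      have "trunc (Suc m) i = (trunc m \<otimes>\<^bsub>H\<^esub> unit (Suc m) [^]\<^bsub>H\<^esub> ?a) i" for i
      proof (cases "i \<in> {1..n}")
        case True
        then have "(unit (Suc m) [^]\<^bsub>H\<^esub> ?a) i = (if i = Suc m then x i else 0)"
          using xi[OF m] by (simp add: pow_H[OF unit_carrier]) (simp add: unit_def)
        then show ?thesis
          using True xi[OF True] xi[OF m] by (auto simp: mult_H trunc_def)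
      qed (auto simp: trunc_def mult_H)
      then have "trunc (Suc m) = trunc m \<otimes>\<^bsub>H\<^esub> unit (Suc m) [^]\<^bsub>H\<^esub> ?a"
        by blast
      moreover have "unit (Suc m) [^]\<^bsub>H\<^esub> ?a \<in> K"
        using H.subgroup_int_pow_closed[OF K units[OF m], of "int ?a"] by (simp only: int_pow_int)
      ultimately show ?case
        using Suc subgroup.m_closed[OF K] by simp
    qed
    moreover have "trunc n = x"
      using x by (auto simp: trunc_def carrier_H PiE_iff extensional_def)
    ultimately show "x \<in> K"
      by (metis order_refl)
  qed
qed

text \<open>The set where two homomorphisms agree is a subgroup, and here it contains every unit
  vector.\<close>

lemma hom_eqI:
  assumes f: "f \<in> hom H H" and g: "g \<in> hom H H"
    and eq: "\<And>k. k \<in> {1..n} \<Longrightarrow> f (unit k) = g (unit k)" and x: "x \<in> carrier H"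
  shows "f x = g x"
proof -
  interpret f: group_hom H H f
    by unfold_locales (rule f)
  interpret g: group_hom H H g
    by unfold_locales (rule g)
  have "subgroup {x \<in> carrier H. f x = g x} H"
    by unfold_locales auto
  then have "{x \<in> carrier H. f x = g x} = carrier H"
    using eq unit_carrier by (intro units_generate) auto
  with x show ?thesis
    by blast
qed

text \<open>The integer combination respects residues, and hence addition, only if \<open>h k\<close> is
  killed by \<open>p ^ e k\<close>.\<close>

definition endo :: "(nat \<Rightarrow> nat \<Rightarrow> int) \<Rightarrow> (nat \<Rightarrow> int) \<Rightarrow> nat \<Rightarrow> int"
  where "endo h = (\<lambda>x\<in>carrier H. \<lambda>i\<in>{1..n}. (\<Sum>k=1..n. x k * h k i) mod int p ^ e i)"

lemma endo_hom:
  assumes h: "\<And>k. k \<in> {1..n} \<Longrightarrow> h k \<in> torsion k"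
  shows "endo h \<in> hom H H"
proof (rule homI)
  show "endo h x \<in> carrier H" if "x \<in> carrier H" for x
  proof -
    have "0 \<le> a mod int p ^ e i" "a mod int p ^ e i < int p ^ e i" for a i
      using pow_pos[of "e i"] by (simp_all only: pos_mod_sign pos_mod_bound)
    then show ?thesis
      unfolding endo_def using that by (simp add: carrier_H)
  qed
  fix x y assume xy: "x \<in> carrier H" "y \<in> carrier H"
  show "endo h (x \<otimes>\<^bsub>H\<^esub> y) = endo h x \<otimes>\<^bsub>H\<^esub> endo h y"
  proof
    fix i
    show "endo h (x \<otimes>\<^bsub>H\<^esub> y) i = (endo h x \<otimes>\<^bsub>H\<^esub> endo h y) i"
    proof (cases "i \<in> {1..n}")
      case True
      \<comment> \<open>Reducing \<open>x k + y k\<close> changes the product by a multiple of p^(e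
        k) times \<open>h k i\<close>, which the torsion condition makes divisible by p^(e
        i).\<close>
      have "((x k + y k) mod int p ^ e k * h k i) mod int p ^ e i
          = ((x k + y k) * h k i) mod int p ^ e i" if "k \<in> {1..n}" for k
      proof -
        have "int p ^ e i dvd int p ^ e k * h k i"
          using h[OF that] True by (simp add: mem_torsion_iff)
        then have "int p ^ e i dvd ((x k + y k) div int p ^ e k) * (int p ^ e k * h k i)"
          by (rule dvd_mult)
        also have "\<dots> = (x k + y k) * h k i - (x k + y k) mod int p ^ e k * h k i"
          by (simp only: minus_mod_eq_div_mult mult.assoc flip: left_diff_distrib)
        finally show ?thesis
          by (metis mod_eq_dvd_iff)
      qed
      then have "(\<Sum>k=1..n. (x \<otimes>\<^bsub>H\<^esub> y) k * h k i) mod int p ^ e i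
          = (\<Sum>k=1..n. ((x k + y k) * h k i) mod int p ^ e i) mod int p ^ e i"
        by (subst mod_sum_eq[symmetric]) (simp add: mult_H)
      also have "\<dots> = ((\<Sum>k=1..n. x k * h k i) + (\<Sum>k=1..n. y k * h k i)) mod int p ^ e i"
        by (simp add: mod_sum_eq sum.distrib distrib_right)
      also have "\<dots> = (endo h x \<otimes>\<^bsub>H\<^esub> endo h y) i"
        using True xy by (simp add: endo_def mult_H mod_add_eq)
      finally show ?thesis
        using True xy H.m_closed[OF xy] by (simp add: endo_def)
    next
      case False
      then show ?thesis
        using xy H.m_closed[OF xy] by (auto simp: endo_def mult_H)
    qed
  qed
qed

lemma endo_unit:
  assumes "k \<in> {1..n}" "h k \<in> carrier H"
  shows "endo h (unit k) = h k"
proof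
  fix i
  have "(\<Sum>j=1..n. unit k j * h j i) = (\<Sum>j=1..n. if j = k then h j i else 0)"
    by (intro sum.cong) (auto simp: unit_def)
  also have "\<dots> = h k i"
    using assms by simp
  finally have sum: "(\<Sum>j=1..n. unit k j * h j i) = h k i" .
  show "endo h (unit k) i = h k i"
  proof (cases "i \<in> {1..n}")
    case True
    then have "h k i mod int p ^ e i = h k i"
      using assms(2) by (simp add: carrier_H PiE_iff)
    then show ?thesis
      using True unit_carrier sum by (simp add: endo_def)
  next
    case False
    then have "endo h (unit k) i = undefined"
      using unit_carrier by (auto simp: endo_def)
    also have "\<dots> = h k i"
      using False assms(2) PiE_arb unfolding carrier_H by metis
    finally show ?thesis .
  qed
qed

text \<open>By the Nakayama argument, \<open>f\<close> is surjective iff the images of the unit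
  vectors generate the group modulo \<open>frattini\<close>; since that quotient has order p^n,
  \<open>n\<close> elements generate it iff they are independent.\<close>

lemma hom_surj_iff:
  assumes f: "f \<in> hom H H"
  shows "f ` carrier H = carrier H \<longleftrightarrow>
    (\<forall>j\<in>{1..n}. f (unit j) \<notin> H.chain frattini (\<lambda>k. f (unit k)) (j - 1))"
proof -
  interpret f: group_hom H H f
    by unfold_locales (rule f)
  let ?h = "\<lambda>k. f (unit k)"
  have h: "?h k \<in> carrier H" for k
    using unit_carrier by simp
  have C: "subgroup (H.chain frattini ?h n) H"
    using subgroup_frattini h by (rule H.subgroup_chain)
  have I: "subgroup (f ` carrier H) H"
    by (rule f.img_is_subgroup)
  have "f ` carrier H = carrier H \<longleftrightarrow> H.chain frattini ?h n = carrier H"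
  proof
    assume surj: "f ` carrier H = carrier H"
    \<comment> \<open>The preimage of the chain is a subgroup containing all unit vectors, so it is
      everything, and the image of \<open>f\<close> lies in the chain.\<close>
    have "{x \<in> carrier H. f x \<in> H.chain frattini ?h n} = carrier H"
    proof (rule units_generate)
      show "subgroup {x \<in> carrier H. f x \<in> H.chain frattini ?h n} H"
        using C by unfold_locales (auto simp: subgroup.m_closed subgroup.one_closed subgroup.m_inv_closed)
      show "unit k \<in> {x \<in> carrier H. f x \<in> H.chain frattini ?h n}" if "k \<in> {1..n}" for k
        using unit_carrier H.mem_chain[OF subgroup_frattini, of n ?h k] h that by auto
    qed
    then have "f ` carrier H \<subseteq> H.chain frattini ?h n"
      by (metis (no_types, lifting) image_subsetI mem_Collect_eq)
    then have "carrier H \<subseteq> H.chain frattini ?h n"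
      by (simp only: surj)
    then show "H.chain frattini ?h n = carrier H"
      using subgroup.subset[OF C] by blast
  next
    assume chain: "H.chain frattini ?h n = carrier H"
    \<comment> \<open>The sum of the image and pH contains every generator of the chain, hence is
      the whole group.\<close>
    let ?S = "f ` carrier H <#>\<^bsub>H\<^esub> frattini"
    have "H.chain frattini ?h n \<subseteq> ?S"
    proof (rule H.chain_least)
      show "subgroup ?S H"
        using I subgroup_frattini by (rule H.mult_subgroups)
      show "frattini \<subseteq> ?S"
      proof
        fix x assume "x \<in> frattini"
        moreover from this have "x = \<one>\<^bsub>H\<^esub> \<otimes>\<^bsub>H\<^esub> x"
          using subgroup.mem_carrier[OF subgroup_frattini] by simp
        ultimately show "x \<in> ?S"
          using subgroup.one_closed[OF I] unfolding set_mult_def by blast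
      qed
      show "?h k \<in> ?S" for k
      proof -
        have "?h k = ?h k \<otimes>\<^bsub>H\<^esub> \<one>\<^bsub>H\<^esub>"
          using h by simp
        then show ?thesis
          using subgroup.one_closed[OF subgroup_frattini] unit_carrier unfolding set_mult_def by blast
      qed
    qed
    then have gen: "\<exists>y\<in>f ` carrier H. \<exists>z\<in>carrier H. x = y \<otimes>\<^bsub>H\<^esub> z [^]\<^bsub>H\<^esub> p" if "x \<in> carrier H" for x
    proof -
      have "x \<in> ?S"
        using that \<open>H.chain frattini ?h n \<subseteq> ?S\<close> chain by blast
      then obtain y w where "y \<in> f ` carrier H" "w \<in> frattini" "x = y \<otimes>\<^bsub>H\<^esub> w"
        unfolding set_mult_def by blast
      then show ?thesis
        by (metis mem_frattini_iff)
    qed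
    \<comment> \<open>The sum of the \<open>e i\<close> is just a convenient common upper bound for
      them, giving one power of \<open>p\<close> that kills the group.\<close>
    have "x [^]\<^bsub>H\<^esub> (p ^ (\<Sum>i=1..n. e i)) = \<one>\<^bsub>H\<^esub>" if "x \<in> carrier H" for x
    proof -
      have "int p ^ e i dvd int p ^ (\<Sum>i=1..n. e i)" if "i \<in> {1..n}" for i
        using member_le_sum[of i "{1..n}" e] that by (intro le_imp_power_dvd) auto
      then show ?thesis
        using that by (auto simp: pow_H one_H fun_eq_iff restrict_def)
    qed
    with I gen show "f ` carrier H = carrier H"
      by (rule H.subgroup_mult_powers_eq_carrier)
  qed
  also have "\<dots> \<longleftrightarrow> (\<forall>j\<in>{1..n}. ?h j \<notin> H.chain frattini ?h (j - 1))"
    using mem_frattini_iff h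
    by (intro H.chain_eq_carrier_iff[OF finite_H subgroup_frattini _ prime_p card_carrier]) auto
  finally show ?thesis .
qed

text \<open>On a finite set surjectivity already gives injectivity. Extensionality appears because
  \<open>Bij\<close> consists of extensional functions.\<close>

lemma auto_iff: "f \<in> auto H \<longleftrightarrow> f \<in> hom H H \<and> f \<in> extensional (carrier H) \<and> f ` carrier H = carrier H"
proof -
  have "inj_on f (carrier H)" if "f ` carrier H = carrier H"
    using that finite_H by (simp add: eq_card_imp_inj_on)
  then show ?thesis
    by (auto simp: auto_def Bij_def bij_betw_def)
qed

text \<open>A homomorphism is determined by the images of the unit vectors, and the image of
  \<open>unit k\<close> is again killed by p^(e k). Conversely \<open>endo\<close> realises every
  tuple from the \<open>torsion k\<close>, and by \<open>hom_surj_iff\<close> independence is what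
  makes the result an automorphism.\<close>

lemma bij_betw_auto_tuples:
  "bij_betw (\<lambda>f. \<lambda>k\<in>{1..n}. f (unit k)) (auto H) (H.independent_tuples frattini torsion n)"
proof (rule bij_betwI[where g = endo])
  have chain_eq: "H.chain frattini (\<lambda>k\<in>{1..n}. h k) (j - 1) = H.chain frattini h (j - 1)"
    if "j \<in> {1..n}" for h j
    using that by (intro H.chain_cong) auto
  show tuples: "(\<lambda>f. \<lambda>k\<in>{1..n}. f (unit k)) \<in> auto H \<rightarrow> H.independent_tuples frattini torsion n"
  proof
    fix f assume "f \<in> auto H"
    then have f: "f \<in> hom H H" "f ` carrier H = carrier H"
      by (auto simp: auto_iff)
    interpret f: group_hom H H f
      by unfold_locales (rule f)
    have "f (unit k) \<in> torsion k" for k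
    proof -
      have "f (unit k) [^]\<^bsub>H\<^esub> (p ^ e k) = f (unit k [^]\<^bsub>H\<^esub> (p ^ e k))"
        using unit_carrier by (simp add: f.hom_nat_pow)
      then show ?thesis
        using unit_torsion[of k] by (simp add: mem_torsion_iff_pow)
    qed
    then show "(\<lambda>k\<in>{1..n}. f (unit k)) \<in> H.independent_tuples frattini torsion n"
      using hom_surj_iff[OF f(1)] f(2) chain_eq[of _ "\<lambda>k. f (unit k)"]
      by (auto simp: H.independent_tuples_def)
  qed
  have tor: "h k \<in> torsion k" and ext: "h \<in> extensional {1..n}"
    and indep: "h k \<notin> H.chain frattini h (k - 1)"
    if "h \<in> H.independent_tuples frattini torsion n" "k \<in> {1..n}" for h k
    using that by (auto simp: H.independent_tuples_def PiE_iff)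
  have unit: "endo h (unit k) = h k"
    if "h \<in> H.independent_tuples frattini torsion n" "k \<in> {1..n}" for h k
    using tor[OF that] that(2) by (intro endo_unit) (auto simp: mem_torsion_iff)
  have hom: "endo h \<in> hom H H" if "h \<in> H.independent_tuples frattini torsion n" for h
    using tor[OF that] by (rule endo_hom)
  show "endo \<in> H.independent_tuples frattini torsion n \<rightarrow> auto H"
  proof
    fix h assume h: "h \<in> H.independent_tuples frattini torsion n"
    have "H.chain frattini (\<lambda>k. endo h (unit k)) (j - 1) = H.chain frattini h (j - 1)"
      if "j \<in> {1..n}" for j
      using that unit[OF h] by (intro H.chain_cong) auto
    then have "endo h ` carrier H = carrier H"
      using indep[OF h] unit[OF h] by (simp add: hom_surj_iff[OF hom[OF h]])
    then show "endo h \<in> auto H"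
      using hom[OF h] by (simp add: auto_iff) (simp add: endo_def)
  qed
  show "(\<lambda>k\<in>{1..n}. endo h (unit k)) = h" if "h \<in> H.independent_tuples frattini torsion n" for h
    using that unit[OF that] by (auto simp: H.independent_tuples_def PiE_iff extensional_def)
  fix f assume f: "f \<in> auto H"
  let ?h = "\<lambda>k\<in>{1..n}. f (unit k)"
  have h: "?h \<in> H.independent_tuples frattini torsion n"
    using tuples f by (rule funcset_mem)
  show "endo ?h = f"
  proof (rule extensionalityI)
    show "endo ?h \<in> extensional (carrier H)" "f \<in> extensional (carrier H)"
      using f by (auto simp: auto_iff endo_def)
    show "endo ?h x = f x" if "x \<in> carrier H" for x
    proof (rule hom_eqI[OF hom[OF h] _ _ that])
      show "f \<in> hom H H"
        using f by (simp add: auto_iff)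
      show "endo ?h (unit k) = f (unit k)" if "k \<in> {1..n}" for k
        using unit[OF h that] that by simp
    qed
  qed
qed

section \<open>Subgroup orders and the exponents in the formula\<close>

lemma order_AutoGroup:
  "int (order (AutoGroup H)) =
    (\<Prod>k=1..n. int (card (torsion k)) - int p ^ (k - 1) * int (card (torsion k \<inter> frattini)))"
proof -
  have "order (AutoGroup H) = card (auto H)"
    by (simp add: order_def AutoGroup_def)
  also have "\<dots> = card (H.independent_tuples frattini torsion n)"
    by (rule bij_betw_same_card[OF bij_betw_auto_tuples])
  finally have "order (AutoGroup H) = card (H.independent_tuples frattini torsion n)" .
  moreover have "int (card (H.independent_tuples frattini torsion n)) =
      (\<Prod>k=1..n. int (card (torsion k)) - int p ^ (k - 1) * int (card (torsion k \<inter> frattini)))"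
  proof (rule H.card_independent_tuples[OF finite_H subgroup_frattini _ prime_p subgroup_torsion])
    show "torsion i \<subseteq> torsion j" if "1 \<le> i" "i \<le> j" "j \<le> n" for i j
      using that by (intro torsion_mono) auto
  qed (auto simp: mem_frattini_iff)
  ultimately show ?thesis
    by simp
qed

text \<open>Coordinate \<open>i\<close> runs through the multiples of \<open>p\<close> to the power
  \<open>max (e i - e k) 1\<close>. This maximum is 1 if e i <= e k; otherwise it is
  \<open>e i - e k\<close>, which leaves p^(e k) residues.\<close>

lemma card_torsion_Int_frattini:
  assumes k: "k \<in> {1..n}"
  shows "card (torsion k \<inter> frattini) =
    (\<Prod>i=1..n. if e i \<le> e k then p ^ (e i - 1) else p ^ e k)"
proof -
  have "card (torsion k \<inter> frattini) = (\<Prod>i=1..n. p ^ (e i - max (e i - e k) 1))"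
    unfolding torsion_def frattini_def multiples_Int using e_pos by (intro card_multiples) auto
  also have "\<dots> = (\<Prod>i=1..n. if e i \<le> e k then p ^ (e i - 1) else p ^ e k)"
  proof (rule prod.cong[OF refl])
    fix i assume "i \<in> {1..n}"
    have "e i - max (e i - e k) 1 = (if e i \<le> e k then e i - 1 else e k)"
      by auto
    then show "p ^ (e i - max (e i - e k) 1) = (if e i \<le> e k then p ^ (e i - 1) else p ^ e k)"
      by simp
  qed
  finally show ?thesis .
qed

text \<open>Passing to pH costs a factor \<open>p\<close> in each coordinate with e i <= e k; in the
  other coordinates the torsion elements are already divisible by \<open>p\<close>.\<close>

lemma card_torsion:
  assumes k: "k \<in> {1..n}"
  shows "card (torsion k) = p ^ card {i \<in> {1..n}. e i \<le> e k} * card (torsion k \<inter> frattini)"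
proof -
  have "card (torsion k) = (\<Prod>i=1..n. p ^ (e i - (e i - e k)))"
    unfolding torsion_def by (rule card_multiples) simp
  also have "\<dots> = (\<Prod>i=1..n. (if e i \<le> e k then p else 1) *
      (if e i \<le> e k then p ^ (e i - 1) else p ^ e k))"
  proof (rule prod.cong[OF refl])
    fix i assume "i \<in> {1..n}"
    then show "p ^ (e i - (e i - e k)) =
        (if e i \<le> e k then p else 1) * (if e i \<le> e k then p ^ (e i - 1) else p ^ e k)"
      using e_pos[of i] by (cases "e i") auto
  qed
  also have "\<dots> = (\<Prod>i=1..n. if e i \<le> e k then p else 1) * card (torsion k \<inter> frattini)"
    by (simp only: prod.distrib card_torsion_Int_frattini[OF k])
  also have "(\<Prod>i=1..n. if e i \<le> e k then p else 1) = p ^ card {i \<in> {1..n}. e i \<le> e k}"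
    by (simp add: prod.If_cases Int_def)
  finally show ?thesis .
qed

text \<open>By monotonicity these indices form an initial segment, which ends with the block of
  indices sharing the value \<open>e k\<close>. So the number of factors \<open>p\<close> counted in
  \<open>card_torsion\<close> is d_k.\<close>

lemma last_equal_eq:
  assumes k: "k \<in> {1..n}"
  shows "{i \<in> {1..n}. e i \<le> e k} = {1..last_equal n e k}" "last_equal n e k \<le> n"
proof -
  let ?L = "{l \<in> {1..n}. e l = e k}" and ?d = "last_equal n e k"
  have d: "?d \<in> ?L"
    unfolding last_equal_def using k by (intro Max_in) auto
  then show "?d \<le> n"
    by simp
  have "i \<le> ?d" if "i \<in> {1..n}" "e i \<le> e k" for i
  proof (cases "e i = e k")
    case True
    then show ?thesis
      unfolding last_equal_def using that by (intro Max_ge) auto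
  next
    case False
    then show ?thesis
      using that d mono_onD[OF e_mono, of ?d i] by force
  qed
  moreover have "e i \<le> e k" if "i \<in> {1..?d}" for i
    using that d mono_onD[OF e_mono, of i ?d] by auto
  ultimately show "{i \<in> {1..n}. e i \<le> e k} = {1..?d}"
    using d by auto
qed

text \<open>Dual to \<open>last_equal_eq\<close>: here \<open>i\<close> is fixed and
  \<open>k\<close> varies, so the indices form a final segment, with n - c_i + 1 members.\<close>

lemma first_equal_eq:
  assumes i: "i \<in> {1..n}"
  shows "{k \<in> {1..n}. e i \<le> e k} = {first_equal n e i..n}" "first_equal n e i \<le> n"
proof -
  let ?L = "{l \<in> {1..n}. e l = e i}" and ?c = "first_equal n e i"
  have c: "?c \<in> ?L"
    unfolding first_equal_def using i by (intro Min_in) auto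
  then show "?c \<le> n"
    by simp
  have "?c \<le> k" if "k \<in> {1..n}" "e i \<le> e k" for k
  proof (cases "e k = e i")
    case True
    then show ?thesis
      unfolding first_equal_def using that by (intro Min_le) auto
  next
    case False
    then show ?thesis
      using that c mono_onD[OF e_mono, of k ?c] by force
  qed
  moreover have "e i \<le> e k" if "k \<in> {?c..n}" for k
    using that c mono_onD[OF e_mono, of ?c k] by auto
  ultimately show "{k \<in> {1..n}. e i \<le> e k} = {?c..n}"
    using c by auto
qed

text \<open>The left side is a double product over pairs (i, k). Pairs with e i > e k contribute
  p^(e k), and each \<open>k\<close> has n - d_k of them. Pairs with e i <= e k contribute p^(e i -
  1); after exchanging the two products, each \<open>i\<close> has n - c_i + 1 of them.\<close>

lemma prod_card_torsion_Int_frattini: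
  "(\<Prod>k=1..n. card (torsion k \<inter> frattini)) =
    (\<Prod>j=1..n. (p ^ e j) ^ (n - last_equal n e j)) *
    (\<Prod>i=1..n. (p ^ (e i - 1)) ^ (n - first_equal n e i + 1))"
proof -
  have "(\<Prod>k=1..n. card (torsion k \<inter> frattini)) =
      (\<Prod>k=1..n. (\<Prod>i=1..n. if e i \<le> e k then 1 else p ^ e k) *
        (\<Prod>i=1..n. if e i \<le> e k then p ^ (e i - 1) else 1))"
    by (intro prod.cong refl, subst card_torsion_Int_frattini, simp, subst prod.distrib[symmetric])
       (auto intro!: prod.cong)
  also have "\<dots> = (\<Prod>k=1..n. \<Prod>i=1..n. if e i \<le> e k then 1 else p ^ e k) *
      (\<Prod>i=1..n. \<Prod>k=1..n. if e i \<le> e k then p ^ (e i - 1) else 1)"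
    unfolding prod.distrib by (subst (3) prod.swap) (rule refl)
  finally have split: "(\<Prod>k=1..n. card (torsion k \<inter> frattini)) =
      (\<Prod>k=1..n. \<Prod>i=1..n. if e i \<le> e k then 1 else p ^ e k) *
      (\<Prod>i=1..n. \<Prod>k=1..n. if e i \<le> e k then p ^ (e i - 1) else 1)" .
  have large: "(\<Prod>k=1..n. \<Prod>i=1..n. if e i \<le> e k then 1 else p ^ e k) =
      (\<Prod>k=1..n. (p ^ e k) ^ (n - last_equal n e k))"
  proof (rule prod.cong[OF refl])
    fix k assume k: "k \<in> {1..n}"
    have "{1..n} \<inter> - {i. e i \<le> e k} = {1..n} - {1..last_equal n e k}"
      unfolding last_equal_eq(1)[OF k, symmetric] by blast
    then show "(\<Prod>i=1..n. if e i \<le> e k then 1 else p ^ e k) = (p ^ e k) ^ (n - last_equal n e k)"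
      using last_equal_eq(2)[OF k] by (simp add: prod.If_cases card_Diff_subset)
  qed
  have small: "(\<Prod>i=1..n. \<Prod>k=1..n. if e i \<le> e k then p ^ (e i - 1) else 1) =
      (\<Prod>i=1..n. (p ^ (e i - 1)) ^ (n - first_equal n e i + 1))"
  proof (rule prod.cong[OF refl])
    fix i assume i: "i \<in> {1..n}"
    have "{1..n} \<inter> {k. e i \<le> e k} = {first_equal n e i..n}"
      unfolding first_equal_eq(1)[OF i, symmetric] by blast
    then show "(\<Prod>k=1..n. if e i \<le> e k then p ^ (e i - 1) else 1) =
        (p ^ (e i - 1)) ^ (n - first_equal n e i + 1)"
      using first_equal_eq(2)[OF i] by (simp add: prod.If_cases Suc_diff_le)
  qed
  show ?thesis
    using split by (simp only: large small)
qed

end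

section \<open>The order of the automorphism group\<close>

theorem theorem4p1:
  fixes p n :: nat and e :: "nat \<Rightarrow> nat"
  assumes "prime p"
    and "1 \<le> n"
    and "1 \<le> e 1"
    and "mono_on {1..n} e"
  defines "d \<equiv> last_equal n e" and "c \<equiv> first_equal n e"
  shows "int (order (AutoGroup (H_group p n e))) =
           (\<Prod>k=1..n. int p ^ d k - int p ^ (k - 1)) *
           (\<Prod>j=1..n. (int p ^ e j) ^ (n - d j)) *
           (\<Prod>i=1..n. (int p ^ (e i - 1)) ^ (n - c i + 1))"
proof -
  have "1 \<le> e i" if "i \<in> {1..n}" for i
    using that assms(3) mono_onD[OF assms(4), of 1 i] by auto
  then interpret H_group_context p n e
    using assms(1,4) by unfold_locales
  have "int (order (AutoGroup H)) =
      (\<Prod>k=1..n. (int p ^ d k - int p ^ (k - 1)) * int (card (torsion k \<inter> frattini)))"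
    unfolding order_AutoGroup
  proof (rule prod.cong[OF refl])
    fix k assume k: "k \<in> {1..n}"
    show "int (card (torsion k)) - int p ^ (k - 1) * int (card (torsion k \<inter> frattini)) =
        (int p ^ d k - int p ^ (k - 1)) * int (card (torsion k \<inter> frattini))"
      unfolding card_torsion[OF k] last_equal_eq(1)[OF k] d_def by (simp add: left_diff_distrib)
  qed
  also have "\<dots> = (\<Prod>k=1..n. int p ^ d k - int p ^ (k - 1)) *
      int (\<Prod>k=1..n. card (torsion k \<inter> frattini))"
    by (simp add: prod.distrib)
  finally show ?thesis
    unfolding prod_card_torsion_Int_frattini by (simp add: d_def c_def mult.assoc)
qed

end
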